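(* There exists a functor $$-\otimes_{\mathbb{F}_1}\mathbb{Z}:\ \mathbb{F}_1\mathbf{Mod}\to\mathbf{Ab},$$ given on objects by $X\mapsto X\otimes_{\mathbb{F}_1}\mathbb{Z}$ (the abelian group defined in the context), which is left adjoint to the Eilenberg-MacLane functor $H:\mathbf{Ab}\to\mathbb{F}_1\mathbf{Mod}$. That is, for any $\mathbb{F}_1$-module $X$ and abelian group $M$ there is a bijection, natural in $X$ and $M$, $$\mathrm{Hom}_{\mathbb{F}_1\mathbf{Mod}}(X,HM)\cong\mathrm{Hom}_{\mathbf{Ab}}(X\otimes_{\mathbb{F}_1}\mathbb{Z},M).$$
   Context: **$\mathbb{F}_1$-modules.** $\Gamma^{\mathrm{op}}$ is the category whose objects are the pointed finite sets $n_+=\{0,1,\ldots,n\}$, $n\ge 0$, with basepoint $0$, and whose morphisms are basepoint-preserving maps. An $\mathbb{F}_1$-module ($=\Gamma$-set) is a pointed functor $X:\Gamma^{\mathrm{op}}\to\mathbf{Set}_*$ to pointed sets (pointed: $X(0_+)=\{*\}$). Morphisms are natural transformations; the category is denoted $\mathbb{F}_1\mathbf{Mod}$. $\mathbf{Ab}$ is the category of abelian groups. **Binary sums.** Let $p_1,p_2,s:2_+\to1_+$ be the pointed maps with $p_1(1)=1,\ p_1(2)=0$; $p_2(1)=0,\ p_2(2)=1$; $s(1)=s(2)=1$. For $a,b\in X(1_+)$, $$a\oplus b:=\{X(s)(z)\mid z\in X(2_+),\ X(p_1)(z)=a,\ X(p_2)(z)=b\}\subseteq X(1_+).$$ **Eilenberg-MacLane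 functor.** For an abelian group $M$, $HM$ is the $\Gamma$-set with $HM(n_+)=M^{\oplus n}$ (basepoint $(0,\ldots,0)$) and, for $f:n_+\to k_+$, $HM(f)(m_1,\ldots,m_n)=\left(\sum_{f(i)=1}m_i,\ldots,\sum_{f(i)=k}m_i\right)$. On morphisms $H$ applies a homomorphism coordinatewise. **Extension of scalars.** For an $\mathbb{F}_1$-module $X$, $X\otimes_{\mathbb{F}_1}\mathbb{Z}:=\mathbb{Z}[X(1_+)]/\mathcal{R}$, where $\mathbb{Z}[X(1_+)]$ is the free abelian group on the set $X(1_+)$ with generators $[a]$, $a\in X(1_+)$, and $\mathcal{R}$ is the subgroup generated by $[*]$ (where $*$ is the basepoint of $X(1_+)$) and by all $[a]+[b]-[c]$ with $a,b,c\in X(1_+)$ and $c\in a\oplus b$. *)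

theory Defs
  imports "HOL-Algebra.Free_Abelian_Groups"
begin

section \<open>Categories and functors\<close>

text \<open>
  A morphism is represented by a value that does not record its source and target, so composition
  and the action of a functor on morphisms take the objects as additional arguments.
  \<open>comp C X Y Z g f\<close> is the composite of \<open>f : X \<rightarrow> Y\<close> and \<open>g : Y \<rightarrow> Z\<close>.
\<close>

record ('o, 'm) category =
  obj :: "'o set"
  mor :: "'o \<Rightarrow> 'o \<Rightarrow> 'm set"
  ident :: "'o \<Rightarrow> 'm"
  comp :: "'o \<Rightarrow> 'o \<Rightarrow> 'o \<Rightarrow> 'm \<Rightarrow> 'm \<Rightarrow> 'm"

definition is_category :: "('o, 'm) category \<Rightarrow> bool" where
  "is_category C \<longleftrightarrow>
    (\<forall>X\<in>obj C. ident C X \<in> mor C X X) \<and>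
    (\<forall>X\<in>obj C. \<forall>Y\<in>obj C. \<forall>Z\<in>obj C. \<forall>f\<in>mor C X Y. \<forall>g\<in>mor C Y Z.
       comp C X Y Z g f \<in> mor C X Z) \<and>
    (\<forall>X\<in>obj C. \<forall>Y\<in>obj C. \<forall>f\<in>mor C X Y.
       comp C X X Y f (ident C X) = f \<and> comp C X Y Y (ident C Y) f = f) \<and>
    (\<forall>W\<in>obj C. \<forall>X\<in>obj C. \<forall>Y\<in>obj C. \<forall>Z\<in>obj C.
       \<forall>f\<in>mor C W X. \<forall>g\<in>mor C X Y. \<forall>h\<in>mor C Y Z.
         comp C W Y Z h (comp C W X Y g f) = comp C W X Z (comp C X Y Z h g) f)"

record ('o1, 'm1, 'o2, 'm2) cfunctor =
  on_obj :: "'o1 \<Rightarrow> 'o2"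
  on_mor :: "'o1 \<Rightarrow> 'o1 \<Rightarrow> 'm1 \<Rightarrow> 'm2"

definition is_functor ::
  "('o1, 'm1) category \<Rightarrow> ('o2, 'm2) category \<Rightarrow> ('o1, 'm1, 'o2, 'm2) cfunctor \<Rightarrow> bool" where
  "is_functor C D F \<longleftrightarrow>
    (\<forall>X\<in>obj C. on_obj F X \<in> obj D) \<and>
    (\<forall>X\<in>obj C. \<forall>Y\<in>obj C. \<forall>f\<in>mor C X Y. on_mor F X Y f \<in> mor D (on_obj F X) (on_obj F Y)) \<and>
    (\<forall>X\<in>obj C. on_mor F X X (ident C X) = ident D (on_obj F X)) \<and>
    (\<forall>X\<in>obj C. \<forall>Y\<in>obj C. \<forall>Z\<in>obj C. \<forall>f\<in>mor C X Y. \<forall>g\<in>mor C Y Z.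
       on_mor F X Z (comp C X Y Z g f) =
       comp D (on_obj F X) (on_obj F Y) (on_obj F Z) (on_mor F Y Z g) (on_mor F X Y f))"


section \<open>Pointed sets and the category \<open>\<Gamma>\<^sup>o\<^sup>p\<close>\<close>

record 'a pset =
  pts :: "'a set"
  base :: 'a

text \<open>
  Maps are extensional (\<^term>\<open>undefined\<close> outside their domain), so that two maps are equal
  as HOL functions iff they agree on their domain; likewise for all morphisms below.
\<close>

definition pmap :: "'a pset \<Rightarrow> 'b pset \<Rightarrow> ('a \<Rightarrow> 'b) set" where
  "pmap P Q = {f \<in> pts P \<rightarrow>\<^sub>E pts Q. f (base P) = base Q}"

definition PSet :: "('a pset, 'a \<Rightarrow> 'a) category" where
  "PSet = \<lparr>obj = {P. base P \<in> pts P},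
           mor = pmap,
           ident = (\<lambda>P. \<lambda>x\<in>pts P. x),
           comp = (\<lambda>P Q R g f. compose (pts P) g f)\<rparr>"

definition nplus :: "nat \<Rightarrow> nat pset" where
  "nplus n = \<lparr>pts = {0..n}, base = 0\<rparr>"

definition GammaOp :: "(nat, nat \<Rightarrow> nat) category" where
  "GammaOp = \<lparr>obj = UNIV,
              mor = (\<lambda>n k. pmap (nplus n) (nplus k)),
              ident = (\<lambda>n. \<lambda>i\<in>pts (nplus n). i),
              comp = (\<lambda>n k l g f. compose (pts (nplus n)) g f)\<rparr>"


section \<open>\<open>\<bbbF>\<^sub>1\<close>-modules\<close>

type_synonym 'a f1mod = "(nat, nat \<Rightarrow> nat, 'a pset, 'a \<Rightarrow> 'a) cfunctor"

definition is_f1mod :: "'a f1mod \<Rightarrow> bool" where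
  "is_f1mod X \<longleftrightarrow> is_functor GammaOp PSet X \<and> pts (on_obj X 0) = {base (on_obj X 0)}"

text \<open>
  Natural transformations and their composition are defined between modules whose elements
  may have different types, since the elements of \<open>HM\<close> are tuples of elements of \<open>M\<close>.
\<close>

definition f1_hom :: "'a f1mod \<Rightarrow> 'b f1mod \<Rightarrow> (nat \<Rightarrow> 'a \<Rightarrow> 'b) set" where
  "f1_hom X Y =
    {\<alpha>. (\<forall>n. \<alpha> n \<in> pmap (on_obj X n) (on_obj Y n)) \<and>
        (\<forall>n k. \<forall>f\<in>mor GammaOp n k. \<forall>x\<in>pts (on_obj X n).
           \<alpha> k (on_mor X n k f x) = on_mor Y n k f (\<alpha> n x))}"

definition f1_comp ::
  "'a f1mod \<Rightarrow> (nat \<Rightarrow> 'b \<Rightarrow> 'c) \<Rightarrow> (nat \<Rightarrow> 'a \<Rightarrow> 'b) \<Rightarrow> nat \<Rightarrow> 'a \<Rightarrow> 'c" where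
  "f1_comp X \<beta> \<alpha> = (\<lambda>n. compose (pts (on_obj X n)) (\<beta> n) (\<alpha> n))"

definition F1Mod :: "('a f1mod, nat \<Rightarrow> 'a \<Rightarrow> 'a) category" where
  "F1Mod = \<lparr>obj = {X. is_f1mod X},
            mor = f1_hom,
            ident = (\<lambda>X n. \<lambda>x\<in>pts (on_obj X n). x),
            comp = (\<lambda>X Y Z \<beta> \<alpha>. f1_comp X \<beta> \<alpha>)\<rparr>"


section \<open>Abelian groups\<close>

definition ab_hom :: "'a monoid \<Rightarrow> 'b monoid \<Rightarrow> ('a \<Rightarrow> 'b) set" where
  "ab_hom A B = hom A B \<inter> extensional (carrier A)"

definition ab_comp :: "'a monoid \<Rightarrow> ('b \<Rightarrow> 'c) \<Rightarrow> ('a \<Rightarrow> 'b) \<Rightarrow> 'a \<Rightarrow> 'c" where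
  "ab_comp A g f = compose (carrier A) g f"

definition Ab :: "('a monoid, 'a \<Rightarrow> 'a) category" where
  "Ab = \<lparr>obj = {A. comm_group A},
         mor = ab_hom,
         ident = (\<lambda>A. \<lambda>x\<in>carrier A. x),
         comp = (\<lambda>A B C g f. ab_comp A g f)\<rparr>"


section \<open>The Eilenberg-MacLane functor\<close>

text \<open>
  Abelian groups are written multiplicatively here, so the sums in the usual description become
  \<^const>\<open>finprod\<close>. An element of \<open>M\<close> to the power \<open>n\<close> is an extensional function on \<open>{1..n}\<close>.
\<close>

definition EM_obj :: "'b monoid \<Rightarrow> (nat \<Rightarrow> 'b) f1mod" where
  "EM_obj M =
    \<lparr>on_obj = (\<lambda>n. \<lparr>pts = carrier (product_group {1..n} (\<lambda>_. M)),
                     base = \<one>\<^bsub>product_group {1..n} (\<lambda>_. M)\<^esub>\<rparr>),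
     on_mor = (\<lambda>n k f. \<lambda>m\<in>carrier (product_group {1..n} (\<lambda>_. M)).
                 \<lambda>j\<in>{1..k}. finprod M m {i\<in>{1..n}. f i = j})\<rparr>"

definition EM :: "('b monoid, 'b \<Rightarrow> 'b, (nat \<Rightarrow> 'b) f1mod, nat \<Rightarrow> (nat \<Rightarrow> 'b) \<Rightarrow> (nat \<Rightarrow> 'b)) cfunctor"
  where
  "EM = \<lparr>on_obj = EM_obj,
         on_mor = (\<lambda>M N h n. \<lambda>m\<in>carrier (product_group {1..n} (\<lambda>_. M)). \<lambda>i\<in>{1..n}. h (m i))\<rparr>"


section \<open>Extension of scalars\<close>

definition gp1 :: "nat \<Rightarrow> nat" where
  "gp1 = (\<lambda>i\<in>{0..2}. if i = 1 then 1 else 0)"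

definition gp2 :: "nat \<Rightarrow> nat" where
  "gp2 = (\<lambda>i\<in>{0..2}. if i = 2 then 1 else 0)"

definition gs :: "nat \<Rightarrow> nat" where
  "gs = (\<lambda>i\<in>{0..2}. if i = 0 then 0 else 1)"

definition bsum :: "'a f1mod \<Rightarrow> 'a \<Rightarrow> 'a \<Rightarrow> 'a set" where
  "bsum X a b = {on_mor X 2 1 gs z | z.
     z \<in> pts (on_obj X 2) \<and> on_mor X 2 1 gp1 z = a \<and> on_mor X 2 1 gp2 z = b}"

definition tensor_rel :: "'a f1mod \<Rightarrow> ('a \<Rightarrow>\<^sub>0 int) set" where
  "tensor_rel X = generate (free_Abelian_group (pts (on_obj X 1)))
     (insert (frag_of (base (on_obj X 1)))
       {frag_of a + frag_of b - frag_of c | a b c.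
          a \<in> pts (on_obj X 1) \<and> b \<in> pts (on_obj X 1) \<and> c \<in> pts (on_obj X 1) \<and> c \<in> bsum X a b})"

definition tensor_Z :: "'a f1mod \<Rightarrow> ('a \<Rightarrow>\<^sub>0 int) set monoid" where
  "tensor_Z X = free_Abelian_group (pts (on_obj X 1)) Mod tensor_rel X"


section \<open>Well-formedness\<close>

lemma PSet_category: "is_category PSet"
  unfolding is_category_def PSet_def pmap_def
  by (auto simp: compose_def PiE_iff extensional_def fun_eq_iff)

lemma GammaOp_category: "is_category GammaOp"
  unfolding is_category_def GammaOp_def pmap_def nplus_def
  by (auto simp: compose_def PiE_iff extensional_def fun_eq_iff Pi_iff)

lemma gamma_maps: "gp1 \<in> mor GammaOp 2 1" "gp2 \<in> mor GammaOp 2 1" "gs \<in> mor GammaOp 2 1"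
  by (auto simp: gp1_def gp2_def gs_def GammaOp_def pmap_def nplus_def)

lemma f1mod_mor:
  assumes "is_f1mod X" "f \<in> mor GammaOp n k"
  shows "on_mor X n k f \<in> pmap (on_obj X n) (on_obj X k)"
  using assms unfolding is_f1mod_def is_functor_def PSet_def GammaOp_def by simp

lemma F1Mod_category: "is_category F1Mod"
proof -
  have 1: "f1_comp X \<beta> \<alpha> \<in> f1_hom X Z"
    if X: "is_f1mod X" and a: "\<alpha> \<in> f1_hom X Y" and b: "\<beta> \<in> f1_hom Y Z" for X Y Z :: "'a f1mod" and \<alpha> \<beta>
  proof -
    have "f1_comp X \<beta> \<alpha> n \<in> pmap (on_obj X n) (on_obj Z n)" for n
    proof -
      have "base (on_obj X n) \<in> pts (on_obj X n)"
        using X by (auto simp: is_f1mod_def is_functor_def PSet_def GammaOp_def)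
      moreover have "\<alpha> n \<in> pmap (on_obj X n) (on_obj Y n)" "\<beta> n \<in> pmap (on_obj Y n) (on_obj Z n)"
        using a b by (auto simp: f1_hom_def)
      ultimately show ?thesis
        by (auto simp: f1_comp_def pmap_def compose_def)
    qed
    moreover have "f1_comp X \<beta> \<alpha> k (on_mor X n k f x) = on_mor Z n k f (f1_comp X \<beta> \<alpha> n x)"
      if f: "f \<in> mor GammaOp n k" and x: "x \<in> pts (on_obj X n)" for n k f x
    proof -
      have "on_mor X n k f x \<in> pts (on_obj X k)"
        using f1mod_mor[OF X f] x by (auto simp: pmap_def)
      moreover have "\<alpha> n x \<in> pts (on_obj Y n)"
        using a x by (auto simp: f1_hom_def pmap_def)
      ultimately show ?thesis
        using a b f x by (simp add: f1_comp_def compose_def f1_hom_def)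
    qed
    ultimately show ?thesis by (simp add: f1_hom_def)
  qed
  have 2: "(\<lambda>n. \<lambda>x\<in>pts (on_obj X n). x) \<in> f1_hom X X" if X: "is_f1mod X" for X :: "'a f1mod"
  proof -
    have "base (on_obj X n) \<in> pts (on_obj X n)" for n
      using X by (auto simp: is_f1mod_def is_functor_def PSet_def GammaOp_def)
    then show ?thesis
      using f1mod_mor[OF X] by (fastforce simp: f1_hom_def pmap_def)
  qed
  have 3: "f1_comp X \<alpha> (\<lambda>n. \<lambda>x\<in>pts (on_obj X n). x) = \<alpha>"
          "f1_comp X (\<lambda>n. \<lambda>x\<in>pts (on_obj Y n). x) \<alpha> = \<alpha>"
    if a: "\<alpha> \<in> f1_hom X Y" for X Y :: "'a f1mod" and \<alpha>
  proof -
    have "\<alpha> n \<in> pts (on_obj X n) \<rightarrow>\<^sub>E pts (on_obj Y n)" for n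
      using a by (auto simp: f1_hom_def pmap_def)
    then have "compose (pts (on_obj X n)) (\<alpha> n) (\<lambda>x\<in>pts (on_obj X n). x) = \<alpha> n"
              "compose (pts (on_obj X n)) (\<lambda>x\<in>pts (on_obj Y n). x) (\<alpha> n) = \<alpha> n" for n
      by (auto simp: PiE_def intro!: compose_Id Id_compose)
    then show "f1_comp X \<alpha> (\<lambda>n. \<lambda>x\<in>pts (on_obj X n). x) = \<alpha>"
              "f1_comp X (\<lambda>n. \<lambda>x\<in>pts (on_obj Y n). x) \<alpha> = \<alpha>"
      by (simp_all add: f1_comp_def)
  qed
  have 4: "f1_comp W h (f1_comp W g f) = f1_comp W (f1_comp X h g) f"
    if "f \<in> f1_hom W X" for W X :: "'a f1mod" and f g h :: "nat \<Rightarrow> 'a \<Rightarrow> 'a"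
  proof
    fix n
    have "f n \<in> pts (on_obj W n) \<rightarrow> pts (on_obj X n)"
      using that by (auto simp: f1_hom_def pmap_def)
    then show "f1_comp W h (f1_comp W g f) n = f1_comp W (f1_comp X h g) f n"
      unfolding f1_comp_def by (rule compose_assoc)
  qed
  show ?thesis
    unfolding is_category_def F1Mod_def using 1 2 3 4 by simp
qed

lemma Ab_category: "is_category Ab"
proof -
  have 1: "ab_comp W h (ab_comp W g f) = ab_comp W (ab_comp X h g) f"
    if "f \<in> ab_hom W X" for W X :: "'a monoid" and f g h :: "'a \<Rightarrow> 'a"
    using that by (auto simp: ab_comp_def ab_hom_def hom_def intro!: compose_assoc)
  have 2: "(\<lambda>x\<in>carrier A. x) \<in> ab_hom A A" if "comm_group A" for A :: "'a monoid"
  proof -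
    interpret comm_group A by fact
    show ?thesis by (auto simp: ab_hom_def hom_def)
  qed
  have 3: "ab_comp A g f \<in> ab_hom A C"
    if "comm_group A" "f \<in> ab_hom A B" "g \<in> ab_hom B C" for A B C :: "'a monoid" and f g
  proof -
    interpret comm_group A by fact
    show ?thesis using that(2,3)
      by (auto simp: ab_hom_def ab_comp_def hom_def compose_def Pi_iff)
  qed
  have 4: "ab_comp A f (\<lambda>x\<in>carrier A. x) = f" "ab_comp A (\<lambda>x\<in>carrier B. x) f = f"
    if "f \<in> ab_hom A B" for A B :: "'a monoid" and f
    using that by (auto simp: ab_hom_def ab_comp_def hom_def intro!: compose_Id Id_compose)
  show ?thesis
    unfolding is_category_def Ab_def using 1 2 3 4 by simp
qed

lemma tensor_Z_comm_group: "comm_group (tensor_Z X)" if "is_f1mod X"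
proof -
  let ?G = "free_Abelian_group (pts (on_obj X 1))"
  interpret comm_group ?G by (rule abelian_free_Abelian_group)
  have "base (on_obj X 1) \<in> pts (on_obj X 1)"
    using that by (auto simp: is_f1mod_def is_functor_def PSet_def GammaOp_def)
  then have "subgroup (tensor_rel X) ?G"
    unfolding tensor_rel_def
    by (intro generate_is_subgroup)
       (auto simp: dest!: subsetD[OF keys_diff] subsetD[OF keys_add] split: if_splits)
  then show ?thesis
    unfolding tensor_Z_def by (rule abelian_FactGroup)
qed

lemma EM_obj_f1mod:
  assumes "comm_group M"
  shows "is_f1mod (EM_obj M)"
proof -
  interpret comm_group M by fact
  have fin: "finprod M m {i\<in>{1..n}. P i} \<in> carrier M"
    if "m \<in> {1..n} \<rightarrow>\<^sub>E carrier M" for m and n :: nat and P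
    using that by (intro finprod_closed) auto
  have base: "(\<lambda>j\<in>{1..k}. finprod M (\<lambda>i\<in>{1..n}. \<one>\<^bsub>M\<^esub>) {i\<in>{1..n}. f i = j}) = (\<lambda>j\<in>{1..k}. \<one>\<^bsub>M\<^esub>)"
    for f :: "nat \<Rightarrow> nat" and n k
    by (rule restrict_ext) (auto intro!: finprod_one_eqI)
  have ident: "(\<lambda>j\<in>{1..n}. finprod M m {i\<in>{1..n}. (\<lambda>i\<in>{0..n}. i) i = j}) = m"
    if m: "m \<in> {1..n} \<rightarrow>\<^sub>E carrier M" for n :: nat and m
  proof (rule PiE_ext[OF _ m])
    show "(\<lambda>j\<in>{1..n}. finprod M m {i\<in>{1..n}. (\<lambda>i\<in>{0..n}. i) i = j}) \<in> {1..n} \<rightarrow>\<^sub>E carrier M"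
      using fin[OF m] by auto
    fix j assume j: "j \<in> {1..n}"
    then have "{i\<in>{1..n}. (\<lambda>i\<in>{0..n}. i) i = j} = {j}" by auto
    then show "(\<lambda>j\<in>{1..n}. finprod M m {i\<in>{1..n}. (\<lambda>i\<in>{0..n}. i) i = j}) j = m j"
      using j m PiE_mem[OF m j] by simp
  qed
  have comp: "finprod M m {i\<in>{1..n}. compose {0..n} g f i = j} =
      finprod M (\<lambda>j\<in>{1..k}. finprod M m {i\<in>{1..n}. f i = j}) {i\<in>{1..k}. g i = j}"
    if m: "m \<in> {1..n} \<rightarrow>\<^sub>E carrier M" and f: "f \<in> mor GammaOp n k" and g: "g \<in> mor GammaOp k l"
      and j: "j \<in> {1..l}" for m n k l f g j
  proof -
    have g0: "g 0 = 0" and fk: "\<And>i. i \<in> {1..n} \<Longrightarrow> f i \<le> k"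
      using f g by (auto simp: GammaOp_def pmap_def nplus_def PiE_iff)
    have *: "{i\<in>{1..n}. compose {0..n} g f i = j} = (\<Union>i'\<in>{i\<in>{1..k}. g i = j}. {i\<in>{1..n}. f i = i'})"
    proof -
      have "f i \<ge> 1" if "g (f i) = j" for i
        using that j g0 by (cases "f i") auto
      then show ?thesis using fk by (auto simp: compose_def)
    qed
    have "finprod M m (\<Union>i'\<in>{i\<in>{1..k}. g i = j}. {i\<in>{1..n}. f i = i'}) =
        finprod M (\<lambda>i'. finprod M m {i\<in>{1..n}. f i = i'}) {i\<in>{1..k}. g i = j}"
      using m by (intro finprod_UN_disjoint) (auto simp: pairwise_def disjnt_def)
    also have "\<dots> = finprod M (\<lambda>j\<in>{1..k}. finprod M m {i\<in>{1..n}. f i = j}) {i\<in>{1..k}. g i = j}"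
      using fin[OF m] by (intro finprod_cong') auto
    finally show ?thesis unfolding * .
  qed
  have "is_functor GammaOp PSet (EM_obj M)"
    unfolding is_functor_def
  proof (intro conjI ballI)
    fix n k l :: nat and f g assume f: "f \<in> mor GammaOp n k" and g: "g \<in> mor GammaOp k l"
    have "on_mor (EM_obj M) n l (compose {0..n} g f) m =
       compose (pts (on_obj (EM_obj M) n)) (on_mor (EM_obj M) k l g) (on_mor (EM_obj M) n k f) m" for m
    proof (cases "m \<in> {1..n} \<rightarrow>\<^sub>E carrier M")
      case True
      then have "(\<lambda>j\<in>{1..k}. finprod M m {i\<in>{1..n}. f i = j}) \<in> {1..k} \<rightarrow>\<^sub>E carrier M"
        using fin[OF True] by auto
      with True show ?thesis
        using comp[OF True f g]
        by (simp add: EM_obj_def compose_eq del: restrict_PiE cong: restrict_cong)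
    qed (simp add: EM_obj_def compose_def)
    then show "on_mor (EM_obj M) n l (comp GammaOp n k l g f) =
       comp PSet (on_obj (EM_obj M) n) (on_obj (EM_obj M) k) (on_obj (EM_obj M) l)
         (on_mor (EM_obj M) k l g) (on_mor (EM_obj M) n k f)"
      by (auto simp: GammaOp_def PSet_def nplus_def)
  next
    fix n :: nat
    show "on_mor (EM_obj M) n n (ident GammaOp n) = ident PSet (on_obj (EM_obj M) n)"
      using ident[of _ n] by (auto simp: EM_obj_def GammaOp_def PSet_def nplus_def fun_eq_iff)
  next
    fix n k :: nat and f assume f: "f \<in> mor GammaOp n k"
    show "on_mor (EM_obj M) n k f \<in> mor PSet (on_obj (EM_obj M) n) (on_obj (EM_obj M) k)"
      using fin base[where f = f and n = n and k = k] by (auto simp: EM_obj_def PSet_def pmap_def)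
  next
    fix n :: nat
    show "on_obj (EM_obj M) n \<in> obj PSet"
      by (auto simp: EM_obj_def PSet_def)
  qed
  then show ?thesis
    by (auto simp: is_f1mod_def EM_obj_def)
qed

lemma hom_finprod_comm:
  assumes "comm_group M" "comm_group N" "h \<in> hom M N" "finite A" "m \<in> A \<rightarrow> carrier M"
  shows "h (finprod M m A) = finprod N (\<lambda>i. h (m i)) A"
proof -
  interpret M: comm_group M by fact
  interpret N: comm_group N by fact
  have "h \<one>\<^bsub>M\<^esub> = \<one>\<^bsub>N\<^esub>"
    using assms(3) M.is_group N.is_group by (rule hom_one)
  with \<open>finite A\<close> \<open>m \<in> A \<rightarrow> carrier M\<close> show ?thesis
  proof (induction A)
    case (insert a A)
    then have "m a \<in> carrier M" "m \<in> A \<rightarrow> carrier M" by auto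
    moreover have "h (m i) \<in> carrier N" if "i \<in> insert a A" for i
      using assms(3) insert.prems(1) that by (auto simp: hom_def Pi_iff)
    ultimately show ?case
      using insert assms(3) by (simp add: Pi_iff hom_mult)
  qed simp
qed

lemma EM_functor: "is_functor Ab F1Mod EM"
  unfolding is_functor_def
proof (intro conjI ballI)
  fix M :: "'a monoid" assume "M \<in> obj Ab"
  then show "on_obj EM M \<in> obj F1Mod"
    by (simp add: Ab_def F1Mod_def EM_def EM_obj_f1mod)
next
  fix M :: "'a monoid" assume "M \<in> obj Ab"
  show "on_mor EM M M (ident Ab M) = ident F1Mod (on_obj EM M)"
    by (fastforce simp: Ab_def F1Mod_def EM_def EM_obj_def fun_eq_iff PiE_iff extensional_def)
next
  fix M N L :: "'a monoid" and f g assume "f \<in> mor Ab M N" "g \<in> mor Ab N L"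
  then show "on_mor EM M L (comp Ab M N L g f) =
      comp F1Mod (on_obj EM M) (on_obj EM N) (on_obj EM L) (on_mor EM N L g) (on_mor EM M N f)"
    by (fastforce simp: Ab_def F1Mod_def EM_def EM_obj_def fun_eq_iff PiE_iff extensional_def
        ab_hom_def hom_def Pi_iff ab_comp_def f1_comp_def compose_def)
next
  fix M N :: "'a monoid" and h assume MN: "M \<in> obj Ab" "N \<in> obj Ab" and h: "h \<in> mor Ab M N"
  then have M: "comm_group M" and N: "comm_group N" and hom: "h \<in> hom M N"
    by (auto simp: Ab_def ab_hom_def)
  interpret M: comm_group M by fact
  interpret N: comm_group N by fact
  have h1: "h \<one>\<^bsub>M\<^esub> = \<one>\<^bsub>N\<^esub>"
    using hom M.is_group N.is_group by (rule hom_one)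
  have hc: "h x \<in> carrier N" if "x \<in> carrier M" for x
    using hom that by (auto simp: hom_def)
  have pm: "on_mor EM M N h n \<in> pmap (on_obj (on_obj EM M) n) (on_obj (on_obj EM N) n)" for n
    using h1 hc by (auto simp: EM_def EM_obj_def pmap_def fun_eq_iff PiE_iff)
  have nat: "on_mor EM M N h k (on_mor (on_obj EM M) n k f m) =
      on_mor (on_obj EM N) n k f (on_mor EM M N h n m)"
    if f: "f \<in> mor GammaOp n k" and m: "m \<in> pts (on_obj (on_obj EM M) n)" for n k f m
  proof -
    have m': "m \<in> {1..n} \<rightarrow>\<^sub>E carrier M"
      using m by (simp add: EM_def EM_obj_def)
    have c: "(\<lambda>j\<in>{1..k}. finprod M m {i\<in>{1..n}. f i = j}) \<in> {1..k} \<rightarrow>\<^sub>E carrier M"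
      using m' by (auto intro!: M.finprod_closed)
    have c': "(\<lambda>i\<in>{1..n}. h (m i)) \<in> {1..n} \<rightarrow>\<^sub>E carrier N"
      using m' hc by auto
    have eq: "h (finprod M m {i\<in>{1..n}. f i = j}) =
        finprod N (\<lambda>i\<in>{1..n}. h (m i)) {i\<in>{1..n}. f i = j}" for j
    proof -
      have "h (finprod M m {i\<in>{1..n}. f i = j}) = finprod N (\<lambda>i. h (m i)) {i\<in>{1..n}. f i = j}"
        using m' by (intro hom_finprod_comm[OF M N hom]) auto
      also have "\<dots> = finprod N (\<lambda>i\<in>{1..n}. h (m i)) {i\<in>{1..n}. f i = j}"
        using m' by (intro N.finprod_cong') (auto intro!: hc)
      finally show ?thesis .
    qed
    have "on_mor EM M N h k (on_mor (on_obj EM M) n k f m) =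
        (\<lambda>j\<in>{1..k}. h (finprod M m {i\<in>{1..n}. f i = j}))"
      using m' c by (simp add: EM_def EM_obj_def fun_eq_iff del: restrict_PiE)
    also have "\<dots> = (\<lambda>j\<in>{1..k}. finprod N (\<lambda>i\<in>{1..n}. h (m i)) {i\<in>{1..n}. f i = j})"
      using eq by (simp only:)
    also have "\<dots> = on_mor (on_obj EM N) n k f (on_mor EM M N h n m)"
      using m' c' by (simp add: EM_def EM_obj_def del: restrict_PiE)
    finally show ?thesis .
  qed
  show "on_mor EM M N h \<in> mor F1Mod (on_obj EM M) (on_obj EM N)"
    using pm nat by (simp add: F1Mod_def f1_hom_def)
qed

end

(* Both Hom sets are identified with the set of additive maps from the underlying set X(1_+) to M,
   that is, maps f with f(base) = 0 and f(c) = f(a) + f(b) whenever c is in a (+) b.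
   On the tensor side this is the presentation of the tensor product by generators and relations.
   On the Eilenberg-MacLane side a natural transformation is determined by its component at 1_+,
   since the i-th coordinate of HM(n_+) is its image under the map n_+ -> 1_+ that sends only i to 1.
   Conversely, the coordinatewise extension of an additive map is natural by induction on the size
   of a fibre, where one element is split off by means of a map n_+ -> 2_+. *)

theory Submission
  imports Defs
begin

section \<open>Modules over \<open>\<bbbF>\<^sub>1\<close>\<close>

lemma f1mod_base:
  assumes "is_f1mod X"
  shows "base (on_obj X n) \<in> pts (on_obj X n)"
  using assms by (auto simp: is_f1mod_def is_functor_def PSet_def GammaOp_def)

lemma f1mod_closed:
  assumes "is_f1mod X" "f \<in> mor GammaOp n k" "x \<in> pts (on_obj X n)"
  shows "on_mor X n k f x \<in> pts (on_obj X k)"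
  using f1mod_mor[OF assms(1,2)] assms(3) by (auto simp: pmap_def)

lemma f1mod_map_base:
  assumes "is_f1mod X" "f \<in> mor GammaOp n k"
  shows "on_mor X n k f (base (on_obj X n)) = base (on_obj X k)"
  using f1mod_mor[OF assms] by (auto simp: pmap_def)

lemma f1mod_ident:
  assumes "is_f1mod X" "x \<in> pts (on_obj X n)"
  shows "on_mor X n n (\<lambda>i\<in>{0..n}. i) x = x"
proof -
  have "on_mor X n n (\<lambda>i\<in>{0..n}. i) = (\<lambda>x\<in>pts (on_obj X n). x)"
    using assms(1) by (auto simp: is_f1mod_def is_functor_def PSet_def GammaOp_def nplus_def)
  with assms(2) show ?thesis by simp
qed

lemma f1mod_comp:
  assumes "is_f1mod X" "f \<in> mor GammaOp n k" "g \<in> mor GammaOp k l" "x \<in> pts (on_obj X n)"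
  shows "on_mor X k l g (on_mor X n k f x) = on_mor X n l (compose {0..n} g f) x"
proof -
  have "is_functor GammaOp PSet X" using assms(1) by (simp add: is_f1mod_def)
  then have "on_mor X n l (comp GammaOp n k l g f) =
      comp PSet (on_obj X n) (on_obj X k) (on_obj X l) (on_mor X k l g) (on_mor X n k f)"
    using assms(2,3) unfolding is_functor_def by (simp add: GammaOp_def)
  with assms(4) show ?thesis
    by (simp add: GammaOp_def PSet_def nplus_def compose_eq)
qed

lemma f1_hom_closed:
  assumes "\<alpha> \<in> f1_hom X Y" "x \<in> pts (on_obj X n)"
  shows "\<alpha> n x \<in> pts (on_obj Y n)"
  using assms by (auto simp: f1_hom_def pmap_def)

lemma f1_hom_base:
  assumes "\<alpha> \<in> f1_hom X Y"
  shows "\<alpha> n (base (on_obj X n)) = base (on_obj Y n)"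
  using assms by (auto simp: f1_hom_def pmap_def)

lemma f1_hom_natural:
  assumes "\<alpha> \<in> f1_hom X Y" "f \<in> mor GammaOp n k" "x \<in> pts (on_obj X n)"
  shows "\<alpha> k (on_mor X n k f x) = on_mor Y n k f (\<alpha> n x)"
  using assms by (auto simp: f1_hom_def)

section \<open>Binary sums and their transport along module maps\<close>

lemma bsum_in_pts:
  assumes "is_f1mod X" "c \<in> bsum X a b"
  shows "a \<in> pts (on_obj X 1)" "b \<in> pts (on_obj X 1)" "c \<in> pts (on_obj X 1)"
  using assms f1mod_closed[OF assms(1) gamma_maps(1)] f1mod_closed[OF assms(1) gamma_maps(2)]
    f1mod_closed[OF assms(1) gamma_maps(3)]
  by (auto simp: bsum_def)

text \<open>A witness \<open>z\<close> for the sum is carried to the witness \<open>f 2 z\<close>,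
  because naturality lets \<open>f\<close> pass through each of \<open>gp1\<close>,
  \<open>gp2\<close> and \<open>gs\<close>.\<close>

lemma bsum_f1_hom:
  assumes f: "f \<in> f1_hom X Y" and c: "c \<in> bsum X a b"
  shows "f 1 c \<in> bsum Y (f 1 a) (f 1 b)"
proof -
  obtain z where z: "z \<in> pts (on_obj X 2)" "c = on_mor X 2 1 gs z"
      "on_mor X 2 1 gp1 z = a" "on_mor X 2 1 gp2 z = b"
    using c by (auto simp: bsum_def)
  note nat = f1_hom_natural[OF f _ z(1)]
  show ?thesis
    unfolding bsum_def
    using z nat[OF gamma_maps(1)] nat[OF gamma_maps(2)] nat[OF gamma_maps(3)]
      f1_hom_closed[OF f z(1)] by (intro CollectI exI[of _ "f 2 z"]) auto
qed


section \<open>Additive maps\<close>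

text \<open>The middle term through which both Hom sets are compared. Here \<open>a\<close> and
  \<open>b\<close> range over the whole type, but in a module a nonempty \<open>bsum X a b\<close>
  already places them in X(1_+), by \<open>bsum_in_pts\<close>.\<close>

definition additive_maps :: "'a f1mod \<Rightarrow> 'b monoid \<Rightarrow> ('a \<Rightarrow> 'b) set" where
  "additive_maps X M =
    {\<phi> \<in> pts (on_obj X 1) \<rightarrow>\<^sub>E carrier M. \<phi> (base (on_obj X 1)) = \<one>\<^bsub>M\<^esub> \<and>
       (\<forall>a b. \<forall>c\<in>bsum X a b. \<phi> c = \<phi> a \<otimes>\<^bsub>M\<^esub> \<phi> b)}"

lemma additive_mapsD:
  assumes "\<phi> \<in> additive_maps X M"
  shows "\<phi> \<in> pts (on_obj X 1) \<rightarrow>\<^sub>E carrier M"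
    and "\<phi> (base (on_obj X 1)) = \<one>\<^bsub>M\<^esub>"
    and "c \<in> bsum X a b \<Longrightarrow> \<phi> c = \<phi> a \<otimes>\<^bsub>M\<^esub> \<phi> b"
  using assms by (auto simp: additive_maps_def)

text \<open>Contravariance in the module: \<open>f 1\<close> preserves the basepoint and, by
  \<open>bsum_f1_hom\<close>, binary sums.\<close>

lemma additive_maps_compose_f1_hom:
  assumes X: "is_f1mod X" and f: "f \<in> f1_hom X Y" and \<phi>: "\<phi> \<in> additive_maps Y M"
  shows "compose (pts (on_obj X 1)) \<phi> (f 1) \<in> additive_maps X M"
proof -
  have "f 1 x \<in> pts (on_obj Y 1)" if "x \<in> pts (on_obj X 1)" for x
    using f1_hom_closed[OF f that] .
  then show ?thesis
    using additive_mapsD[OF \<phi>] f1mod_base[OF X] f1_hom_base[OF f] bsum_f1_hom[OF f]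
      bsum_in_pts[OF X]
    by (auto simp: additive_maps_def compose_def PiE_iff)
qed

text \<open>Covariance in the group: a homomorphism preserves the unit and products.\<close>

lemma additive_maps_compose_hom:
  assumes X: "is_f1mod X" and M: "group M" and N: "group N" and h: "h \<in> hom M N"
    and \<phi>: "\<phi> \<in> additive_maps X M"
  shows "compose (pts (on_obj X 1)) h \<phi> \<in> additive_maps X N"
proof -
  have "h (\<phi> x) \<in> carrier N" "\<phi> x \<in> carrier M" if "x \<in> pts (on_obj X 1)" for x
    using that h additive_mapsD(1)[OF \<phi>] by (auto simp: hom_def PiE_iff)
  then show ?thesis
    using additive_mapsD[OF \<phi>] f1mod_base[OF X] hom_one[OF h M N] bsum_in_pts[OF X] hom_mult[OF h]
    by (auto simp: additive_maps_def compose_def PiE_iff)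
qed


section \<open>The universal property of the tensor product\<close>

text \<open>\<open>Ab_category\<close> gives closure under composition for a single carrier type
  only. Here the three types may differ, as they do for composites from the tensor product into
  \<open>M\<close>.\<close>

lemma ab_comp_closed:
  assumes "group A" "f \<in> ab_hom A B" "g \<in> ab_hom B C"
  shows "ab_comp A g f \<in> ab_hom A C"
proof -
  interpret group A by fact
  show ?thesis
    using assms(2,3) by (auto simp: ab_hom_def ab_comp_def hom_def compose_def Pi_iff)
qed

section \<open>Generator classes and the defining relations\<close>

definition tensor_class :: "'a f1mod \<Rightarrow> 'a \<Rightarrow> ('a \<Rightarrow>\<^sub>0 int) set" where
  "tensor_class X a = tensor_rel X #>\<^bsub>free_Abelian_group (pts (on_obj X 1))\<^esub> frag_of a"

lemma tensor_rel_normal: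
  assumes "is_f1mod X"
  shows "tensor_rel X \<lhd> free_Abelian_group (pts (on_obj X 1))"
proof -
  interpret comm_group "free_Abelian_group (pts (on_obj X 1))"
    by (rule abelian_free_Abelian_group)
  have "subgroup (tensor_rel X) (free_Abelian_group (pts (on_obj X 1)))"
    unfolding tensor_rel_def using f1mod_base[OF assms]
    by (intro generate_is_subgroup)
       (auto simp: dest!: subsetD[OF keys_diff] subsetD[OF keys_add] split: if_splits)
  then show ?thesis by (rule subgroup_imp_normal)
qed

text \<open>This is the universal additive map: the generators of \<open>tensor_rel X\<close> are
  the conditions of additivity, read in the quotient.\<close>

lemma tensor_class_additive:
  assumes X: "is_f1mod X"
  shows "restrict (tensor_class X) (pts (on_obj X 1)) \<in> additive_maps X (tensor_Z X)"
proof -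
  let ?P = "pts (on_obj X 1)"
  let ?F = "free_Abelian_group ?P"
  interpret F: comm_group ?F by (rule abelian_free_Abelian_group)
  interpret N: normal "tensor_rel X" ?F by (rule tensor_rel_normal[OF X])
  have sub: "subgroup (tensor_rel X) ?F" by (rule N.subgroup_axioms)
  have base: "frag_of (base (on_obj X 1)) \<in> tensor_rel X"
    unfolding tensor_rel_def by (intro generate.incl) auto
  have "tensor_class X (base (on_obj X 1)) = \<one>\<^bsub>tensor_Z X\<^esub>"
    using F.coset_join2[OF _ sub base] f1mod_base[OF X]
    by (simp add: tensor_class_def tensor_Z_def FactGroup_def)
  moreover have "tensor_class X c = tensor_class X a \<otimes>\<^bsub>tensor_Z X\<^esub> tensor_class X b"
    if c: "c \<in> bsum X a b" for a b c
  proof -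
    note P = bsum_in_pts[OF X c]
    have r: "frag_of a + frag_of b - frag_of c \<in> tensor_rel X"
      unfolding tensor_rel_def using P c by (intro generate.incl) auto
    have ab: "frag_of a + frag_of b \<in> carrier ?F"
      using F.m_closed[of "frag_of a" "frag_of b"] P by simp
    \<comment> \<open>Writing [a] + [b] as a relation plus [c] puts it into the coset of [c], so the
      cosets of [a] + [b] and of [c] coincide.\<close>
    have "frag_of a + frag_of b = (frag_of a + frag_of b - frag_of c) \<otimes>\<^bsub>?F\<^esub> frag_of c"
      by simp
    then have "frag_of a + frag_of b \<in> tensor_rel X #>\<^bsub>?F\<^esub> frag_of c"
      using r unfolding r_coset_def by blast
    then have "tensor_rel X #>\<^bsub>?F\<^esub> frag_of c = tensor_rel X #>\<^bsub>?F\<^esub> (frag_of a + frag_of b)"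
      using P sub by (intro F.repr_independence) auto
    then show ?thesis
      using N.rcos_sum[of "frag_of a" "frag_of b"] P
      by (simp add: tensor_class_def tensor_Z_def FactGroup_def)
  qed
  moreover have "tensor_class X a \<in> carrier (tensor_Z X)" if "a \<in> ?P" for a
    using that by (auto simp: tensor_class_def tensor_Z_def FactGroup_def RCOSETS_def)
  ultimately show ?thesis
    using f1mod_base[OF X] bsum_in_pts[OF X] by (auto simp: additive_maps_def)
qed

lemma tensor_class_closed:
  assumes "is_f1mod X" "a \<in> pts (on_obj X 1)"
  shows "tensor_class X a \<in> carrier (tensor_Z X)"
  using additive_mapsD(1)[OF tensor_class_additive[OF assms(1)]] assms(2) by (auto simp: PiE_iff)

text \<open>Uniqueness half of the universal property. Both maps are pulled back along the quotient
  map to the free abelian group, where agreement on generators spreads to all elements by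
  induction.\<close>

lemma tensor_hom_eqI:
  assumes X: "is_f1mod X" and M: "group M"
    and h: "h \<in> ab_hom (tensor_Z X) M" and h': "h' \<in> ab_hom (tensor_Z X) M"
    and eq: "\<And>a. a \<in> pts (on_obj X 1) \<Longrightarrow> h (tensor_class X a) = h' (tensor_class X a)"
  shows "h = h'"
proof -
  let ?P = "pts (on_obj X 1)"
  let ?F = "free_Abelian_group ?P"
  let ?q = "\<lambda>x. tensor_rel X #>\<^bsub>?F\<^esub> x"
  interpret N: normal "tensor_rel X" ?F by (rule tensor_rel_normal[OF X])
  have q: "?q \<in> hom ?F (tensor_Z X)"
    unfolding tensor_Z_def by (rule N.r_coset_hom_Mod)
  have "h \<circ> ?q \<in> hom ?F M" "h' \<circ> ?q \<in> hom ?F M"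
    using q h h' by (auto simp: ab_hom_def intro: hom_compose)
  then interpret g: group_hom ?F M "h \<circ> ?q" + g': group_hom ?F M "h' \<circ> ?q"
    using M by (simp_all add: group_hom_def group_hom_axioms_def)
  have "(h \<circ> ?q) x = (h' \<circ> ?q) x" if "Poly_Mapping.keys x \<subseteq> ?P" for x
  proof (rule free_Abelian_group_induct[OF that])
    show "(h \<circ> ?q) 0 = (h' \<circ> ?q) 0" using g.hom_one g'.hom_one by simp
  next
    fix x y :: "'a \<Rightarrow>\<^sub>0 int"
    assume 2: "Poly_Mapping.keys x \<subseteq> ?P" "Poly_Mapping.keys y \<subseteq> ?P"
      "(h \<circ> ?q) x = (h' \<circ> ?q) x" "(h \<circ> ?q) y = (h' \<circ> ?q) y"
    \<comment> \<open>The induction principle closes under differences; in terms of the group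
      operations the homomorphism laws apply to them.\<close>
    have d: "x - y = x \<otimes>\<^bsub>?F\<^esub> inv\<^bsub>?F\<^esub> y" using 2 by simp
    have x: "x \<in> carrier ?F" and y: "y \<in> carrier ?F" using 2 by simp_all
    note y' = N.inv_closed[OF y]
    show "(h \<circ> ?q) (x - y) = (h' \<circ> ?q) (x - y)"
      unfolding d g.hom_mult[OF x y'] g'.hom_mult[OF x y'] g.hom_inv[OF y] g'.hom_inv[OF y]
      using 2 by simp
  next
    show "(h \<circ> ?q) (frag_of a) = (h' \<circ> ?q) (frag_of a)" if "a \<in> ?P" for a
      using eq[OF that] by (simp add: tensor_class_def)
  qed
  \<comment> \<open>Every element of the quotient is a coset, so agreement descends from the free
    group.\<close>
  then have "h y = h' y" if "y \<in> carrier (tensor_Z X)" for y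
    using that by (auto simp: tensor_Z_def FactGroup_def RCOSETS_def)
  then show ?thesis
    using h h' by (auto simp: ab_hom_def intro: extensionalityI)
qed

text \<open>Existence half of the universal property: \<phi> extends to the free abelian group, its
  additivity kills the relations, and the extension factors through the quotient.\<close>

lemma tensor_hom_exists:
  assumes X: "is_f1mod X" and M: "comm_group M" and \<phi>: "\<phi> \<in> additive_maps X M"
  obtains h where "h \<in> ab_hom (tensor_Z X) M"
    "\<And>a. a \<in> pts (on_obj X 1) \<Longrightarrow> h (tensor_class X a) = \<phi> a"
proof -
  let ?P = "pts (on_obj X 1)"
  let ?F = "free_Abelian_group ?P"
  interpret M: comm_group M by fact
  interpret N: normal "tensor_rel X" ?F by (rule tensor_rel_normal[OF X])
  note add = additive_mapsD[OF \<phi>]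
  have car: "\<phi> a \<in> carrier M" if "a \<in> ?P" for a using that add(1) by auto
  obtain g where g: "g \<in> hom ?F M" and gf: "\<And>a. a \<in> ?P \<Longrightarrow> g (frag_of a) = \<phi> a"
    using M.free_Abelian_group_universal[of \<phi> ?P] car by blast
  interpret g: group_hom ?F M g
    using g M.is_group by (simp add: group_hom_def group_hom_axioms_def)
  have "g (frag_of a + frag_of b - frag_of c) = \<one>\<^bsub>M\<^esub>"
    if P: "a \<in> ?P" "b \<in> ?P" "c \<in> ?P" and c: "c \<in> bsum X a b" for a b c
  proof -
    \<comment> \<open>The relation is expressed by the operations of the free group, so that
      \<open>g\<close> can be evaluated factor by factor.\<close>
    have "frag_of a + frag_of b - frag_of c =
        (frag_of a \<otimes>\<^bsub>?F\<^esub> frag_of b) \<otimes>\<^bsub>?F\<^esub> inv\<^bsub>?F\<^esub> (frag_of c)"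
      using P by simp
    moreover have "frag_of a \<otimes>\<^bsub>?F\<^esub> frag_of b \<in> carrier ?F" "inv\<^bsub>?F\<^esub> (frag_of c) \<in> carrier ?F"
      using P by (intro N.m_closed N.inv_closed; simp)+
    ultimately have "g (frag_of a + frag_of b - frag_of c) =
        (\<phi> a \<otimes>\<^bsub>M\<^esub> \<phi> b) \<otimes>\<^bsub>M\<^esub> inv\<^bsub>M\<^esub> (\<phi> c)"
      using P gf g.hom_mult g.hom_inv[of "frag_of c"] N.is_group
      by (simp del: mult_free_Abelian_group inv_free_Abelian_group)
    then show ?thesis using add(3)[OF c] car P by simp
  qed
  moreover have "g (frag_of (base (on_obj X 1))) = \<one>\<^bsub>M\<^esub>"
    using gf add(2) f1mod_base[OF X] by simp
  \<comment> \<open>The kernel is a subgroup containing all generating relations, hence contains the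
    subgroup they generate.\<close>
  ultimately have "tensor_rel X \<subseteq> kernel ?F M g"
    unfolding tensor_rel_def using f1mod_base[OF X]
    by (intro N.generate_subgroup_incl g.subgroup_kernel)
       (auto simp: kernel_def dest!: subsetD[OF keys_diff] subsetD[OF keys_add] split: if_splits)
  then obtain k where k: "k \<in> hom (tensor_Z X) M"
    "\<And>x. x \<in> carrier ?F \<Longrightarrow> k (tensor_rel X #>\<^bsub>?F\<^esub> x) = g x"
    using g.FactGroup_universal_kernel[OF tensor_rel_normal[OF X]] unfolding tensor_Z_def by metis
  show ?thesis
  proof
    \<comment> \<open>Membership in \<open>ab_hom\<close> demands extensionality, hence the
      restriction. The homomorphism law survives it because the carrier is closed under
      products.\<close>
    show "restrict k (carrier (tensor_Z X)) \<in> ab_hom (tensor_Z X) M"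
      using k(1) comm_group.axioms(2)[OF tensor_Z_comm_group[OF X]]
      by (auto simp: ab_hom_def hom_def group.is_monoid monoid.m_closed)
    show "restrict k (carrier (tensor_Z X)) (tensor_class X a) = \<phi> a" if "a \<in> ?P" for a
      using that k(2)[of "frag_of a"] gf tensor_class_closed[OF X]
      by (simp add: tensor_class_def)
  qed
qed

section \<open>The bijection between homomorphisms out of the tensor product and additive
  maps\<close>

definition tensor_restrict :: "'a f1mod \<Rightarrow> (('a \<Rightarrow>\<^sub>0 int) set \<Rightarrow> 'b) \<Rightarrow> 'a \<Rightarrow> 'b" where
  "tensor_restrict X h = (\<lambda>a\<in>pts (on_obj X 1). h (tensor_class X a))"

lemma tensor_restrict_additive:
  assumes X: "is_f1mod X" and M: "comm_group M" and h: "h \<in> ab_hom (tensor_Z X) M"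
  shows "tensor_restrict X h \<in> additive_maps X M"
proof -
  have "compose (pts (on_obj X 1)) h (restrict (tensor_class X) (pts (on_obj X 1)))
      \<in> additive_maps X M"
    using tensor_Z_comm_group[OF X] M h tensor_class_additive[OF X]
    by (intro additive_maps_compose_hom[OF X]) (auto simp: ab_hom_def comm_group_def)
  then show ?thesis
    by (simp add: tensor_restrict_def compose_def cong: restrict_cong)
qed

lemma tensor_restrict_bij:
  assumes X: "is_f1mod X" and M: "comm_group M"
  shows "bij_betw (tensor_restrict X) (ab_hom (tensor_Z X) M) (additive_maps X M)"
proof (rule bij_betw_imageI)
  show "inj_on (tensor_restrict X) (ab_hom (tensor_Z X) M)"
  proof (rule inj_onI)
    fix h h' assume h: "h \<in> ab_hom (tensor_Z X) M" "h' \<in> ab_hom (tensor_Z X) M"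
      and eq: "tensor_restrict X h = tensor_restrict X h'"
    have "h (tensor_class X a) = h' (tensor_class X a)" if "a \<in> pts (on_obj X 1)" for a
      using fun_cong[OF eq, of a] that by (simp add: tensor_restrict_def)
    then show "h = h'"
      using tensor_hom_eqI[OF X _ h] M by (simp add: comm_group_def)
  qed
  show "tensor_restrict X ` ab_hom (tensor_Z X) M = additive_maps X M"
  proof (intro equalityI subsetI)
    fix \<phi> assume \<phi>: "\<phi> \<in> additive_maps X M"
    obtain h where h: "h \<in> ab_hom (tensor_Z X) M"
      "\<And>a. a \<in> pts (on_obj X 1) \<Longrightarrow> h (tensor_class X a) = \<phi> a"
      using tensor_hom_exists[OF X M \<phi>] by blast
    have "tensor_restrict X h = \<phi>"
      using h(2) additive_mapsD(1)[OF \<phi>]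
      by (auto simp: tensor_restrict_def fun_eq_iff PiE_iff extensional_def)
    then show "\<phi> \<in> tensor_restrict X ` ab_hom (tensor_Z X) M" using h(1) by blast
  qed (auto intro: tensor_restrict_additive[OF X M])
qed

text \<open>Being an inverse of \<open>tensor_restrict X\<close>, it is meaningful on additive maps
  only; \<open>tensor_lift_class\<close> gives its values on generator classes.\<close>

definition tensor_lift :: "'a f1mod \<Rightarrow> 'b monoid \<Rightarrow> ('a \<Rightarrow> 'b) \<Rightarrow> ('a \<Rightarrow>\<^sub>0 int) set \<Rightarrow> 'b" where
  "tensor_lift X M = inv_into (ab_hom (tensor_Z X) M) (tensor_restrict X)"

lemma tensor_lift_bij:
  assumes "is_f1mod X" "comm_group M"
  shows "bij_betw (tensor_lift X M) (additive_maps X M) (ab_hom (tensor_Z X) M)"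
  unfolding tensor_lift_def by (rule bij_betw_inv_into[OF tensor_restrict_bij[OF assms]])

lemma tensor_lift_hom:
  assumes "is_f1mod X" "comm_group M" "\<phi> \<in> additive_maps X M"
  shows "tensor_lift X M \<phi> \<in> ab_hom (tensor_Z X) M"
  using bij_betwE[OF tensor_lift_bij[OF assms(1,2)]] assms(3) by blast

lemma tensor_lift_class:
  assumes X: "is_f1mod X" and M: "comm_group M" and \<phi>: "\<phi> \<in> additive_maps X M"
    and a: "a \<in> pts (on_obj X 1)"
  shows "tensor_lift X M \<phi> (tensor_class X a) = \<phi> a"
proof -
  have "tensor_restrict X (tensor_lift X M \<phi>) = \<phi>"
    unfolding tensor_lift_def using bij_betw_inv_into_right[OF tensor_restrict_bij[OF X M] \<phi>] .
  from fun_cong[OF this, of a] a show ?thesis by (simp add: tensor_restrict_def)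
qed

section \<open>The induced maps [a] to [f(a)] and functoriality of the tensor product\<close>

definition tensor_map ::
  "'a f1mod \<Rightarrow> 'c f1mod \<Rightarrow> (nat \<Rightarrow> 'a \<Rightarrow> 'c) \<Rightarrow> ('a \<Rightarrow>\<^sub>0 int) set \<Rightarrow> ('c \<Rightarrow>\<^sub>0 int) set" where
  "tensor_map X Y f = tensor_lift X (tensor_Z Y)
     (compose (pts (on_obj X 1)) (restrict (tensor_class Y) (pts (on_obj Y 1))) (f 1))"

lemma tensor_map_hom:
  assumes "is_f1mod X" "is_f1mod Y" "f \<in> f1_hom X Y"
  shows "tensor_map X Y f \<in> ab_hom (tensor_Z X) (tensor_Z Y)"
  unfolding tensor_map_def
  by (intro tensor_lift_hom additive_maps_compose_f1_hom[OF assms(1,3)] tensor_class_additive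
      tensor_Z_comm_group assms)

lemma tensor_map_class:
  assumes X: "is_f1mod X" and Y: "is_f1mod Y" and f: "f \<in> f1_hom X Y"
    and a: "a \<in> pts (on_obj X 1)"
  shows "tensor_map X Y f (tensor_class X a) = tensor_class Y (f 1 a)"
  unfolding tensor_map_def
    tensor_lift_class[OF X tensor_Z_comm_group[OF Y]
      additive_maps_compose_f1_hom[OF X f tensor_class_additive[OF Y]] a]
  using a f1_hom_closed[OF f a] by (simp add: compose_def)

definition tensor_functor ::
  "('a f1mod, nat \<Rightarrow> 'a \<Rightarrow> 'a, ('a \<Rightarrow>\<^sub>0 int) set monoid, ('a \<Rightarrow>\<^sub>0 int) set \<Rightarrow> ('a \<Rightarrow>\<^sub>0 int) set) cfunctor"
  where "tensor_functor = \<lparr>on_obj = tensor_Z, on_mor = tensor_map\<rparr>"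

text \<open>Both functor laws are equations between homomorphisms out of a tensor product, so
  \<open>tensor_hom_eqI\<close> reduces them to generator classes, where
  \<open>tensor_map_class\<close> computes both sides.\<close>

lemma is_functor_tensor_functor: "is_functor F1Mod Ab tensor_functor"
  unfolding is_functor_def
proof (intro conjI ballI)
  fix X :: "'a f1mod" assume "X \<in> obj F1Mod"
  then have X: "is_f1mod X" by (simp add: F1Mod_def)
  note TX = tensor_Z_comm_group[OF X]
  show "on_obj tensor_functor X \<in> obj Ab"
    using TX by (simp add: tensor_functor_def Ab_def)
  have id: "ident F1Mod X \<in> f1_hom X X"
    using F1Mod_category X by (auto simp: is_category_def F1Mod_def)
  have "ident Ab (tensor_Z X) \<in> ab_hom (tensor_Z X) (tensor_Z X)"
    using Ab_category TX by (auto simp: is_category_def Ab_def)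
  then have "tensor_map X X (ident F1Mod X) = ident Ab (tensor_Z X)"
    using tensor_map_class[OF X X id] tensor_class_closed[OF X] TX
    by (intro tensor_hom_eqI[OF X _ tensor_map_hom[OF X X id]])
       (auto simp: F1Mod_def Ab_def comm_group_def)
  then show "on_mor tensor_functor X X (ident F1Mod X) = ident Ab (on_obj tensor_functor X)"
    by (simp add: tensor_functor_def)
next
  fix X Y :: "'a f1mod" and f assume "X \<in> obj F1Mod" "Y \<in> obj F1Mod" "f \<in> mor F1Mod X Y"
  then show "on_mor tensor_functor X Y f
      \<in> mor Ab (on_obj tensor_functor X) (on_obj tensor_functor Y)"
    using tensor_map_hom by (simp add: tensor_functor_def F1Mod_def Ab_def)
next
  fix X Y Z :: "'a f1mod" and f g
  assume o: "X \<in> obj F1Mod" "Y \<in> obj F1Mod" "Z \<in> obj F1Mod"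
    and m: "f \<in> mor F1Mod X Y" "g \<in> mor F1Mod Y Z"
  have X: "is_f1mod X" and Y: "is_f1mod Y" and Z: "is_f1mod Z"
    and f: "f \<in> f1_hom X Y" and g: "g \<in> f1_hom Y Z"
    using o m by (simp_all add: F1Mod_def)
  have "comp F1Mod X Y Z g f \<in> mor F1Mod X Z"
    using F1Mod_category o m unfolding is_category_def by blast
  then have gf: "f1_comp X g f \<in> f1_hom X Z" by (simp add: F1Mod_def)
  have gr: "group (tensor_Z X)" "group (tensor_Z Z)"
    using tensor_Z_comm_group X Z by (auto simp: comm_group_def)
  have "tensor_map X Z (f1_comp X g f) =
      ab_comp (tensor_Z X) (tensor_map Y Z g) (tensor_map X Y f)"
  proof (rule tensor_hom_eqI[OF X gr(2) tensor_map_hom[OF X Z gf]])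
    show "ab_comp (tensor_Z X) (tensor_map Y Z g) (tensor_map X Y f)
        \<in> ab_hom (tensor_Z X) (tensor_Z Z)"
      by (rule ab_comp_closed[OF gr(1) tensor_map_hom[OF X Y f] tensor_map_hom[OF Y Z g]])
    fix a assume a: "a \<in> pts (on_obj X 1)"
    show "tensor_map X Z (f1_comp X g f) (tensor_class X a) =
        ab_comp (tensor_Z X) (tensor_map Y Z g) (tensor_map X Y f) (tensor_class X a)"
      using a tensor_map_class[OF X Z gf a] tensor_map_class[OF X Y f a]
        tensor_map_class[OF Y Z g f1_hom_closed[OF f a]] tensor_class_closed[OF X a]
      by (simp add: f1_comp_def ab_comp_def compose_eq)
  qed
  then show "on_mor tensor_functor X Z (comp F1Mod X Y Z g f) =
      comp Ab (on_obj tensor_functor X) (on_obj tensor_functor Y) (on_obj tensor_functor Z)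
        (on_mor tensor_functor Y Z g) (on_mor tensor_functor X Y f)"
    by (simp add: tensor_functor_def F1Mod_def Ab_def)
qed


section \<open>Maps into Eilenberg-MacLane modules\<close>

definition indicator_map :: "nat \<Rightarrow> nat set \<Rightarrow> nat \<Rightarrow> nat" where
  "indicator_map n A = (\<lambda>i\<in>{0..n}. if i \<in> A then 1 else 0)"

lemma indicator_map_mor: "0 \<notin> A \<Longrightarrow> indicator_map n A \<in> mor GammaOp n 1"
  by (auto simp: indicator_map_def GammaOp_def pmap_def nplus_def)

lemma EM_obj_pts: "pts (on_obj (EM_obj M) n) = {1..n} \<rightarrow>\<^sub>E carrier M"
  by (simp add: EM_obj_def)

lemma EM_obj_mor:
  assumes "m \<in> {1..n} \<rightarrow>\<^sub>E carrier M" "j \<in> {1..k}"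
  shows "on_mor (EM_obj M) n k f m j = finprod M m {i\<in>{1..n}. f i = j}"
  using assms by (simp add: EM_obj_def)

text \<open>The fibre over 1 is the single point \<open>i\<close>, so the sum has one term and the
  map is the i-th projection.\<close>

lemma EM_obj_indicator_map:
  assumes M: "comm_group M" and m: "m \<in> {1..n} \<rightarrow>\<^sub>E carrier M" and i: "i \<in> {1..n}"
  shows "on_mor (EM_obj M) n 1 (indicator_map n {i}) m 1 = m i"
proof -
  interpret comm_group M by fact
  have "{l\<in>{1..n}. indicator_map n {i} l = 1} = {i}"
    using i by (auto simp: indicator_map_def)
  then show ?thesis using i m by (subst EM_obj_mor[OF m]) (auto simp: PiE_iff)
qed

text \<open>Elements of HM(1_+) are functions on \<open>{1..1}\<close>; the last argument 1 reads
  off their only coordinate and so identifies HM(1_+) with \<open>M\<close>.\<close>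

definition EM_restrict :: "'a f1mod \<Rightarrow> (nat \<Rightarrow> 'a \<Rightarrow> nat \<Rightarrow> 'b) \<Rightarrow> 'a \<Rightarrow> 'b" where
  "EM_restrict X \<alpha> = (\<lambda>a\<in>pts (on_obj X 1). \<alpha> 1 a 1)"

lemma f1_hom_EM_component:
  assumes M: "comm_group M" and \<alpha>: "\<alpha> \<in> f1_hom X (EM_obj M)"
    and x: "x \<in> pts (on_obj X n)" and i: "i \<in> {1..n}"
  shows "\<alpha> n x i = \<alpha> 1 (on_mor X n 1 (indicator_map n {i}) x) 1"
proof -
  have "\<alpha> n x \<in> {1..n} \<rightarrow>\<^sub>E carrier M" using f1_hom_closed[OF \<alpha> x] by (simp add: EM_obj_pts)
  moreover have "indicator_map n {i} \<in> mor GammaOp n 1"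
    using i by (intro indicator_map_mor) auto
  ultimately show ?thesis
    using f1_hom_natural[OF \<alpha> _ x] EM_obj_indicator_map[OF M _ i] by metis
qed

text \<open>A witness \<open>z\<close> of a binary sum maps to a pair in HM(2_+) whose coordinates
  are the values at \<open>a\<close> and \<open>b\<close>, and HM(s) adds these coordinates.\<close>

lemma EM_restrict_additive:
  assumes X: "is_f1mod X" and M: "comm_group M" and \<alpha>: "\<alpha> \<in> f1_hom X (EM_obj M)"
  shows "EM_restrict X \<alpha> \<in> additive_maps X M"
proof -
  interpret comm_group M by fact
  have car: "\<alpha> 1 a 1 \<in> carrier M" if "a \<in> pts (on_obj X 1)" for a
    using f1_hom_closed[OF \<alpha> that] by (auto simp: EM_obj_pts)
  have "\<alpha> 1 (base (on_obj X 1)) 1 = \<one>\<^bsub>M\<^esub>"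
    using f1_hom_base[OF \<alpha>, of 1] by (simp add: EM_obj_def)
  moreover have "\<alpha> 1 c 1 = \<alpha> 1 a 1 \<otimes>\<^bsub>M\<^esub> \<alpha> 1 b 1" if c: "c \<in> bsum X a b" for a b c
  proof -
    obtain z where z: "z \<in> pts (on_obj X 2)" "c = on_mor X 2 1 gs z"
        "on_mor X 2 1 gp1 z = a" "on_mor X 2 1 gp2 z = b"
      using c by (auto simp: bsum_def)
    have m: "\<alpha> 2 z \<in> {1..2} \<rightarrow>\<^sub>E carrier M"
      using f1_hom_closed[OF \<alpha> z(1)] by (simp add: EM_obj_pts)
    \<comment> \<open>\<open>gp1\<close> and \<open>gp2\<close> are the two coordinate projections,
      so \<open>f1_hom_EM_component\<close> identifies the coordinates of
      \<open>\<alpha> 2 z\<close>.\<close>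
    have "gp1 = indicator_map 2 {1}" "gp2 = indicator_map 2 {2}"
      by (auto simp: gp1_def gp2_def indicator_map_def)
    then have ab: "\<alpha> 2 z 1 = \<alpha> 1 a 1" "\<alpha> 2 z 2 = \<alpha> 1 b 1"
      using f1_hom_EM_component[OF M \<alpha> z(1)] z by auto
    have S: "{i\<in>{1..2}. gs i = 1} = {1, 2}" by (auto simp: gs_def)
    have "\<alpha> 1 c 1 = finprod M (\<alpha> 2 z) {i\<in>{1..2}. gs i = 1}"
      unfolding z(2) f1_hom_natural[OF \<alpha> gamma_maps(3) z(1)] by (rule EM_obj_mor[OF m]) simp
    also have "\<dots> = \<alpha> 2 z 1 \<otimes>\<^bsub>M\<^esub> \<alpha> 2 z 2"
      unfolding S using m by (subst finprod_insert) (auto simp: PiE_iff)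
    finally show ?thesis by (simp only: ab)
  qed
  ultimately show ?thesis
    using car f1mod_base[OF X] bsum_in_pts[OF X] by (auto simp: additive_maps_def EM_restrict_def)
qed

text \<open>Extends additivity from two summands to a finite set \<open>A\<close>. It is applied
  below to the fibres of a pointed map.\<close>

lemma additive_map_indicator_map:
  assumes X: "is_f1mod X" and M: "comm_group M" and \<phi>: "\<phi> \<in> additive_maps X M"
    and x: "x \<in> pts (on_obj X n)" and A: "A \<subseteq> {1..n}"
  shows "\<phi> (on_mor X n 1 (indicator_map n A) x) =
    finprod M (\<lambda>i. \<phi> (on_mor X n 1 (indicator_map n {i}) x)) A"
proof -
  interpret comm_group M by fact
  have ind: "indicator_map n B \<in> mor GammaOp n 1" if "B \<subseteq> {1..n}" for B
    using that by (intro indicator_map_mor) auto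
  have car: "\<phi> (on_mor X n 1 (indicator_map n {i}) x) \<in> carrier M" if "i \<in> {1..n}" for i
    using f1mod_closed[OF X ind x, of "{i}"] additive_mapsD(1)[OF \<phi>] that by auto
  have "finite A" using A finite_subset by blast
  then show ?thesis using A
  proof (induction A)
    case empty
    let ?u = "\<lambda>i\<in>{0..n}. 0::nat" and ?v = "\<lambda>i\<in>{0..0::nat}. 0::nat"
    have uv: "?u \<in> mor GammaOp n 0" "?v \<in> mor GammaOp 0 1"
      by (auto simp: GammaOp_def pmap_def nplus_def)
    \<comment> \<open>The zero map factors through \<open>0\<^sub>+\<close>, and \<open>X\<close> is pointed.\<close>
    have "on_mor X n 0 ?u x = base (on_obj X 0)"
      using f1mod_closed[OF X uv(1) x] X by (auto simp: is_f1mod_def)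
    then have "on_mor X n 1 (compose {0..n} ?v ?u) x = base (on_obj X 1)"
      using f1mod_comp[OF X uv x] f1mod_map_base[OF X uv(2)] by simp
    moreover have "compose {0..n} ?v ?u = indicator_map n {}"
      by (auto simp: compose_def indicator_map_def)
    ultimately show ?case using additive_mapsD(2)[OF \<phi>] by simp
  next
    case (insert a A)
    let ?g = "\<lambda>i\<in>{0..n}. if i = a then 1 else if i \<in> A then 2 else 0::nat"
    have a: "a \<in> {1..n}" and A: "A \<subseteq> {1..n}" "0 \<notin> A" using insert.prems by auto
    have g: "?g \<in> mor GammaOp n 2"
      using a A by (auto simp: GammaOp_def pmap_def nplus_def)
    have "compose {0..n} gp1 ?g = indicator_map n {a}"
      "compose {0..n} gp2 ?g = indicator_map n A"
      "compose {0..n} gs ?g = indicator_map n (insert a A)"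
      using insert.hyps
      by (auto simp: compose_def indicator_map_def gp1_def gp2_def gs_def fun_eq_iff)
    then have "on_mor X n 1 (indicator_map n (insert a A)) x \<in>
        bsum X (on_mor X n 1 (indicator_map n {a}) x) (on_mor X n 1 (indicator_map n A) x)"
      unfolding bsum_def using f1mod_closed[OF X g x]
        f1mod_comp[OF X g gamma_maps(1) x] f1mod_comp[OF X g gamma_maps(2) x]
        f1mod_comp[OF X g gamma_maps(3) x]
      by (intro CollectI exI[of _ "on_mor X n 2 ?g x"]) auto
    from additive_mapsD(3)[OF \<phi> this] show ?case
      using insert car a A by (subst finprod_insert) auto
  qed
qed

lemma EM_restrict_surj:
  assumes X: "is_f1mod X" and M: "comm_group M" and \<phi>: "\<phi> \<in> additive_maps X M"
  obtains \<alpha> where "\<alpha> \<in> f1_hom X (EM_obj M)" "EM_restrict X \<alpha> = \<phi>"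
proof -
  interpret comm_group M by fact
  \<comment> \<open>The only possible choice, by \<open>f1_hom_EM_component\<close>.\<close>
  define \<alpha> where "\<alpha> n = (\<lambda>x\<in>pts (on_obj X n). \<lambda>i\<in>{1..n}.
      \<phi> (on_mor X n 1 (indicator_map n {i}) x))" for n
  note add = additive_mapsD[OF \<phi>]
  have ind: "indicator_map n {i} \<in> mor GammaOp n 1" if "i \<in> {1..n}" for n i
    using that by (intro indicator_map_mor) auto
  have car: "\<phi> (on_mor X n 1 (indicator_map n {i}) x) \<in> carrier M"
    if "i \<in> {1..n}" "x \<in> pts (on_obj X n)" for n i x
    using f1mod_closed[OF X ind[OF that(1)] that(2)] add(1) by auto
  have "\<alpha> n (base (on_obj X n)) = base (on_obj (EM_obj M) n)" for n
    using f1mod_base[OF X] f1mod_map_base[OF X ind] add(2)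
    by (auto simp: \<alpha>_def EM_obj_def intro!: restrict_ext)
  then have pm: "\<alpha> n \<in> pmap (on_obj X n) (on_obj (EM_obj M) n)" for n
    using car by (auto simp: pmap_def EM_obj_pts \<alpha>_def)
  then have \<alpha>E: "\<alpha> n x \<in> {1..n} \<rightarrow>\<^sub>E carrier M" if "x \<in> pts (on_obj X n)" for n x
    using that by (auto simp: pmap_def EM_obj_pts)
  have "\<alpha> k (on_mor X n k f x) = on_mor (EM_obj M) n k f (\<alpha> n x)"
    if f: "f \<in> mor GammaOp n k" and x: "x \<in> pts (on_obj X n)" for n k f x
  proof (rule PiE_ext)
    note fx = f1mod_closed[OF X f x]
    show "\<alpha> k (on_mor X n k f x) \<in> {1..k} \<rightarrow>\<^sub>E carrier M" by (rule \<alpha>E[OF fx])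
    have "\<alpha> n x \<in> pts (on_obj (EM_obj M) n)" using \<alpha>E[OF x] by (simp add: EM_obj_pts)
    from f1mod_closed[OF EM_obj_f1mod[OF M] f this]
    show "on_mor (EM_obj M) n k f (\<alpha> n x) \<in> {1..k} \<rightarrow>\<^sub>E carrier M" by (simp add: EM_obj_pts)
    fix j assume j: "j \<in> {1..k}"
    let ?A = "{i\<in>{1..n}. f i = j}"
    have "f 0 = 0" "f \<in> {0..n} \<rightarrow> {0..k}"
      using f by (auto simp: GammaOp_def pmap_def nplus_def)
    \<comment> \<open>Projecting to coordinate \<open>j\<close> after \<open>f\<close> selects the
      fibre of \<open>f\<close> over \<open>j\<close>. The point 0 is not in this fibre, since
      \<open>f 0 = 0\<close> and \<open>j\<close> is at least 1.\<close>
    then have "compose {0..n} (indicator_map k {j}) f = indicator_map n ?A"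
      using j by (auto simp: compose_def indicator_map_def fun_eq_iff Suc_le_eq intro!: gr0I)
    then have "\<alpha> k (on_mor X n k f x) j = \<phi> (on_mor X n 1 (indicator_map n ?A) x)"
      using fx j f1mod_comp[OF X f ind[OF j] x] by (simp add: \<alpha>_def)
    also have "\<dots> = finprod M (\<lambda>i. \<phi> (on_mor X n 1 (indicator_map n {i}) x)) ?A"
      by (rule additive_map_indicator_map[OF X M \<phi> x]) auto
    also have "\<dots> = finprod M (\<alpha> n x) ?A"
      using \<alpha>E[OF x] x by (intro finprod_cong') (auto simp: \<alpha>_def)
    also have "\<dots> = on_mor (EM_obj M) n k f (\<alpha> n x) j"
      by (rule EM_obj_mor[OF \<alpha>E[OF x] j, symmetric])
    finally show "\<alpha> k (on_mor X n k f x) j = on_mor (EM_obj M) n k f (\<alpha> n x) j" .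
  qed
  with pm have "\<alpha> \<in> f1_hom X (EM_obj M)" by (simp add: f1_hom_def)
  moreover have "EM_restrict X \<alpha> = \<phi>"
  proof -
    \<comment> \<open>The projection at n = 1 is the identity, so the component at 1_+ gives back
      \<phi>.\<close>
    have "indicator_map 1 {1} = (\<lambda>i\<in>{0..1}. i)" by (auto simp: indicator_map_def fun_eq_iff)
    then have "on_mor X 1 1 (indicator_map 1 {1}) x = x" if "x \<in> pts (on_obj X 1)" for x
      using f1mod_ident[OF X that] by (simp only:)
    then show ?thesis
      using add(1)
      by (auto simp: EM_restrict_def \<alpha>_def fun_eq_iff PiE_iff extensional_def)
  qed
  ultimately show ?thesis by (rule that)
qed

lemma EM_restrict_bij:
  assumes X: "is_f1mod X" and M: "comm_group M"
  shows "bij_betw (EM_restrict X) (f1_hom X (EM_obj M)) (additive_maps X M)"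
proof (rule bij_betw_imageI)
  show "inj_on (EM_restrict X) (f1_hom X (EM_obj M))"
  proof (rule inj_onI)
    fix \<alpha> \<beta> assume \<alpha>: "\<alpha> \<in> f1_hom X (EM_obj M)" and \<beta>: "\<beta> \<in> f1_hom X (EM_obj M)"
      and eq: "EM_restrict X \<alpha> = EM_restrict X \<beta>"
    have eq1: "\<alpha> 1 a 1 = \<beta> 1 a 1" if "a \<in> pts (on_obj X 1)" for a
      using fun_cong[OF eq, of a] that by (simp add: EM_restrict_def)
    have "\<alpha> n x = \<beta> n x" if x: "x \<in> pts (on_obj X n)" for n x
    proof (rule PiE_ext)
      show "\<alpha> n x \<in> {1..n} \<rightarrow>\<^sub>E carrier M" "\<beta> n x \<in> {1..n} \<rightarrow>\<^sub>E carrier M"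
        using f1_hom_closed[OF \<alpha> x] f1_hom_closed[OF \<beta> x] by (simp_all add: EM_obj_pts)
      fix i assume i: "i \<in> {1..n}"
      then have "on_mor X n 1 (indicator_map n {i}) x \<in> pts (on_obj X 1)"
        by (intro f1mod_closed[OF X indicator_map_mor x]) auto
      then show "\<alpha> n x i = \<beta> n x i"
        unfolding f1_hom_EM_component[OF M \<alpha> x i] f1_hom_EM_component[OF M \<beta> x i] by (rule eq1)
    qed
    \<comment> \<open>Extensionality turns agreement on X(n_+) into equality of functions.\<close>
    moreover have "\<alpha> n \<in> extensional (pts (on_obj X n))" "\<beta> n \<in> extensional (pts (on_obj X n))"
      for n using \<alpha> \<beta> by (auto simp: f1_hom_def pmap_def PiE_def)
    ultimately show "\<alpha> = \<beta>" 
      by (intro ext[of \<alpha> \<beta>]) (rule extensionalityI)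
  qed
  show "EM_restrict X ` f1_hom X (EM_obj M) = additive_maps X M"
    using EM_restrict_additive[OF X M] EM_restrict_surj[OF X M] by blast
qed

text \<open>Carries a change of both variables over to additive maps: only the component at 1_+ is
  read, and \<open>EM\<close> applies \<open>h\<close> to its coordinate.\<close>

lemma EM_restrict_natural:
  assumes X': "is_f1mod X'" and f: "f \<in> f1_hom X' X" and \<alpha>: "\<alpha> \<in> f1_hom X (EM_obj M)"
  shows "EM_restrict X' (f1_comp X' (on_mor EM M M' h) (f1_comp X' \<alpha> f)) =
    compose (pts (on_obj X' 1)) h (compose (pts (on_obj X' 1)) (EM_restrict X \<alpha>) (f 1))"
proof -
  have "f 1 a \<in> pts (on_obj X 1)" "\<alpha> 1 (f 1 a) \<in> {1..1} \<rightarrow>\<^sub>E carrier M"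
    if "a \<in> pts (on_obj X' 1)" for a
    using f1_hom_closed[OF f that] f1_hom_closed[OF \<alpha> f1_hom_closed[OF f that]]
    by (simp_all add: EM_obj_pts)
  then show ?thesis
    by (auto simp: EM_restrict_def f1_comp_def EM_def compose_def fun_eq_iff)
qed


section \<open>The adjunction bijection and its naturality in both variables\<close>

theorem theorem2:
  shows "\<exists>(T :: ('a f1mod, nat \<Rightarrow> 'a \<Rightarrow> 'a, ('a \<Rightarrow>\<^sub>0 int) set monoid,
                 ('a \<Rightarrow>\<^sub>0 int) set \<Rightarrow> ('a \<Rightarrow>\<^sub>0 int) set) cfunctor)
          (\<Phi> :: 'a f1mod \<Rightarrow> 'b monoid \<Rightarrow> (nat \<Rightarrow> 'a \<Rightarrow> nat \<Rightarrow> 'b) \<Rightarrow> ('a \<Rightarrow>\<^sub>0 int) set \<Rightarrow> 'b).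
    is_functor F1Mod Ab T \<and>
    (\<forall>X\<in>obj F1Mod. on_obj T X = tensor_Z X) \<and>
    (\<forall>X\<in>obj F1Mod. \<forall>M\<in>obj Ab.
       bij_betw (\<Phi> X M) (f1_hom X (on_obj EM M)) (ab_hom (on_obj T X) M)) \<and>
    (\<forall>X\<in>obj F1Mod. \<forall>X'\<in>obj F1Mod. \<forall>M\<in>obj Ab. \<forall>M'\<in>obj Ab.
       \<forall>f\<in>mor F1Mod X' X. \<forall>h\<in>mor Ab M M'. \<forall>\<alpha>\<in>f1_hom X (on_obj EM M).
         \<Phi> X' M' (f1_comp X' (on_mor EM M M' h) (f1_comp X' \<alpha> f)) =
         ab_comp (on_obj T X') h (ab_comp (on_obj T X') (\<Phi> X M \<alpha>) (on_mor T X' X f)))"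
proof (intro exI conjI ballI)
  \<comment> \<open>The two bijections with additive maps are composed: restrict to 1_+, then lift
    to the tensor product.\<close>
  let ?\<Phi> = "\<lambda>(X :: 'a f1mod) (M :: 'b monoid) \<alpha>. tensor_lift X M (EM_restrict X \<alpha>)"
  show "is_functor F1Mod Ab tensor_functor" by (rule is_functor_tensor_functor)
  show "on_obj tensor_functor X = tensor_Z X" for X :: "'a f1mod"
    by (simp add: tensor_functor_def)
  show "bij_betw (?\<Phi> X M) (f1_hom X (on_obj EM M)) (ab_hom (on_obj tensor_functor X) M)"
    if "X \<in> obj F1Mod" "M \<in> obj Ab" for X :: "'a f1mod" and M :: "'b monoid"
  proof -
    have "is_f1mod X" "comm_group M" using that by (simp_all add: F1Mod_def Ab_def)
    from bij_betw_trans[OF EM_restrict_bij[OF this] tensor_lift_bij[OF this]] show ?thesis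
      by (simp add: EM_def tensor_functor_def o_def)
  qed
  fix X X' :: "'a f1mod" and M M' :: "'b monoid" and f h \<alpha>
  assume X: "X \<in> obj F1Mod" and X': "X' \<in> obj F1Mod" and M: "M \<in> obj Ab" and M': "M' \<in> obj Ab"
    and f: "f \<in> mor F1Mod X' X" and h: "h \<in> mor Ab M M'" and \<alpha>: "\<alpha> \<in> f1_hom X (on_obj EM M)"
  note X = X[unfolded F1Mod_def, simplified] and X' = X'[unfolded F1Mod_def, simplified]
    and M = M[unfolded Ab_def, simplified] and M' = M'[unfolded Ab_def, simplified]
    and f = f[unfolded F1Mod_def, simplified] and h = h[unfolded Ab_def, simplified]
    and \<alpha> = \<alpha>[unfolded EM_def, simplified]
  let ?\<phi> = "EM_restrict X \<alpha>"
  \<comment> \<open>By \<open>EM_restrict_natural\<close>, this is the additive map belonging to the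
    transformation on the left of the naturality equation.\<close>
  let ?\<psi> = "compose (pts (on_obj X' 1)) h (compose (pts (on_obj X' 1)) ?\<phi> (f 1))"
  have gr: "group M" "group M'" "group (tensor_Z X')"
    using M M' tensor_Z_comm_group[OF X'] by (simp_all add: comm_group_def)
  have \<phi>: "?\<phi> \<in> additive_maps X M" by (rule EM_restrict_additive[OF X M \<alpha>])
  have \<psi>: "?\<psi> \<in> additive_maps X' M'"
    using h gr additive_maps_compose_f1_hom[OF X' f \<phi>]
    by (intro additive_maps_compose_hom[OF X', of M]) (auto simp: ab_hom_def)
  \<comment> \<open>It is enough to compare on generator classes; both sides send the class of
    \<open>a\<close> to \<open>h (?\<phi> (f 1 a))\<close>.\<close>
  have "tensor_lift X' M' ?\<psi> =
      ab_comp (tensor_Z X') h (ab_comp (tensor_Z X') (tensor_lift X M ?\<phi>) (tensor_map X' X f))"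
  proof (rule tensor_hom_eqI[OF X' gr(2) tensor_lift_hom[OF X' M' \<psi>]])
    show "ab_comp (tensor_Z X') h (ab_comp (tensor_Z X') (tensor_lift X M ?\<phi>) (tensor_map X' X f))
        \<in> ab_hom (tensor_Z X') M'"
      by (intro ab_comp_closed[OF gr(3) _ h] ab_comp_closed[OF gr(3) tensor_map_hom[OF X' X f]]
          tensor_lift_hom[OF X M \<phi>])
    fix a assume a: "a \<in> pts (on_obj X' 1)"
    show "tensor_lift X' M' ?\<psi> (tensor_class X' a) = ab_comp (tensor_Z X') h
        (ab_comp (tensor_Z X') (tensor_lift X M ?\<phi>) (tensor_map X' X f)) (tensor_class X' a)"
      using a tensor_lift_class[OF X' M' \<psi> a] tensor_map_class[OF X' X f a]
        tensor_lift_class[OF X M \<phi> f1_hom_closed[OF f a]] tensor_class_closed[OF X' a]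
      by (simp add: ab_comp_def compose_eq)
  qed
  then show "?\<Phi> X' M' (f1_comp X' (on_mor EM M M' h) (f1_comp X' \<alpha> f)) =
      ab_comp (on_obj tensor_functor X') h
        (ab_comp (on_obj tensor_functor X') (?\<Phi> X M \<alpha>) (on_mor tensor_functor X' X f))"
    by (simp add: EM_restrict_natural[OF X' f \<alpha>] tensor_functor_def)
qed

end
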